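(* The operators $\sigma_1,\dots,\sigma_{n-1}$ on the set of rooted labeled forests on $n$, defined combinatorially in the context, satisfy the braid relations ($\sigma_i\sigma_j=\sigma_j\sigma_i$ if $|i-j|\ge2$, and $\sigma_i\sigma_{i+1}\sigma_i=\sigma_{i+1}\sigma_i\sigma_{i+1}$) and therefore give an action of the braid group $B_n$ on this set.
   Context: A rooted labeled forest on $n$ is a forest with vertices $v_1,\dots,v_n$ and a chosen root in each component. For a forest $F$, $F_+$ denotes the rooted tree obtained by adding a new root $v_0$ (the master root) as the parent of all the roots of $F$. "Siblings" are nodes with the same parent (so roots of $F$ are siblings in $F_+$). Two nodes of $F$ are close if they are siblings in $F_+$ or one is the parent of the other. The braid group $B_n$ has generators $\sigma_1,\dots,\sigma_{n-1}$ subject to the braid relations. For $1\le i<n$ the forest $\sigma_i(F)$ is defined as follows. The nodes labeled $j\ne i,i+1$ keep their names $v_j$, and the nodes of $\sigma_i(F)$ labeled $i,i+1$ are denoted $v_i',v_{i+1}'$. Relations not mentioned below are unchanged. Case 0: if $v_i,v_{i+1}$ are not close, $\sigma_i(F)$ is $F$ with the labels $i,i+1$ switched. Case 1: $v_i$ is the parent of $v_{i+1}$, $v_k$ is the parent of $v_i$ in $F_+$, $X$ is the set of other children of $v_i$, $Y$ the set of children of $v_{i+1}$. Then in $\sigma_i(F)_+$: $v_{i+1}'$ has parent $v_k$ and set of children $Y\cup\{v_i'\}$, and $v_i'$ has set of children $X$. Case 2: $v_i$ is a child of $v_{i+1}$, $v_k$ is the parent of $v_{i+1}$ in $F_+$,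 $Y$ is the set of other children of $v_{i+1}$, $X$ the set of children of $v_i$. Then in $\sigma_i(F)_+$: $v_i'$ and $v_{i+1}'$ are both children of $v_k$, $v_i'$ has set of children $Y$, and $v_{i+1}'$ has set of children $X$. Case 3: $v_i,v_{i+1}$ are siblings in $F_+$ with parent $v_k$, and $Y,X$ are the sets of children of $v_i,v_{i+1}$ respectively. Then in $\sigma_i(F)_+$: $v_i'$ has parent $v_k$ and set of children $X\cup\{v_{i+1}'\}$, and $v_{i+1}'$ has set of children $Y$. *)

theory Defs
  imports "HOL-Algebra.Group_Action"
begin

section \<open>Rooted labeled forests\<close>

text \<open>The vertex labeled \<open>j\<close> is represented by the number \<open>j\<close>, and \<open>0\<close> stands for the master
  root. An edge is a two-element set of vertices; the vertex set \<open>{1..n}\<close> is not stored.\<close>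

record rforest =
  edges :: "nat set set"
  roots :: "nat set"

definition is_path :: "nat set set \<Rightarrow> nat list \<Rightarrow> bool" where
  "is_path E vs \<longleftrightarrow> vs \<noteq> [] \<and> distinct vs \<and> successively (\<lambda>u v. {u, v} \<in> E) vs"

definition component :: "nat set \<Rightarrow> nat set set \<Rightarrow> nat \<Rightarrow> nat set" where
  "component V E v = {w \<in> V. \<exists>vs. is_path E vs \<and> hd vs = v \<and> last vs = w}"

definition acyclic_graph :: "nat set set \<Rightarrow> bool" where
  "acyclic_graph E \<longleftrightarrow> \<not> (\<exists>vs. is_path E vs \<and> length vs \<ge> 3 \<and> {last vs, hd vs} \<in> E)"

definition rooted_forests :: "nat \<Rightarrow> rforest set" where
  "rooted_forests n = {F.
     edges F \<subseteq> {{u, v} | u v. u \<in> {1..n} \<and> v \<in> {1..n} \<and> u \<noteq> v} \<and>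
     acyclic_graph (edges F) \<and>
     roots F \<subseteq> {1..n} \<and>
     (\<forall>v \<in> {1..n}. \<exists>!r. r \<in> roots F \<inter> component {1..n} (edges F) v)}"

definition plus_edges :: "rforest \<Rightarrow> nat set set" where
  "plus_edges F = edges F \<union> {{0, r} | r. r \<in> roots F}"

text \<open>In \<open>F\<^sub>+\<close>, \<open>u\<close> is the parent of \<open>v\<close> if it is the second vertex on the path from \<open>v\<close> to the
  master root.\<close>

definition is_parent :: "rforest \<Rightarrow> nat \<Rightarrow> nat \<Rightarrow> bool" where
  "is_parent F u v \<longleftrightarrow> (\<exists>vs. is_path (plus_edges F) (v # u # vs) \<and> last (u # vs) = 0)"

definition parent :: "rforest \<Rightarrow> nat \<Rightarrow> nat" where
  "parent F v = (THE u. is_parent F u v)"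

definition children :: "rforest \<Rightarrow> nat \<Rightarrow> nat set" where
  "children F u = {v. is_parent F u v}"

definition siblings :: "rforest \<Rightarrow> nat \<Rightarrow> nat \<Rightarrow> bool" where
  "siblings F u v \<longleftrightarrow> u \<noteq> v \<and> (\<exists>k. is_parent F k u \<and> is_parent F k v)"

definition close :: "rforest \<Rightarrow> nat \<Rightarrow> nat \<Rightarrow> bool" where
  "close F u v \<longleftrightarrow> siblings F u v \<or> is_parent F u v \<or> is_parent F v u"

text \<open>The forest \<open>F\<close> on \<open>n\<close> in which the parent of each vertex \<open>v\<close> in \<open>F\<^sub>+\<close> is \<open>p v\<close>.\<close>

definition forest_of_parents :: "nat \<Rightarrow> (nat \<Rightarrow> nat) \<Rightarrow> rforest" where
  "forest_of_parents n p =
     \<lparr>edges = {{v, p v} | v. v \<in> {1..n} \<and> p v \<noteq> 0}, roots = {v \<in> {1..n}. p v = 0}\<rparr>"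

definition relabel :: "(nat \<Rightarrow> nat) \<Rightarrow> rforest \<Rightarrow> rforest" where
  "relabel f F = \<lparr>edges = (`) f ` edges F, roots = f ` roots F\<rparr>"


section \<open>The operators\<close>

text \<open>The branches are Cases 1, 2, 3 and 0, in this order; Cases 1--3 are given by the parent
  of every vertex in \<open>\<sigma>\<^sub>i(F)\<^sub>+\<close>.\<close>

definition sigma :: "nat \<Rightarrow> nat \<Rightarrow> rforest \<Rightarrow> rforest" where
  "sigma n i F =
    (if is_parent F i (i+1) then
       let k = parent F i; X = children F i - {i+1}; Y = children F (i+1)
       in forest_of_parents n (\<lambda>v.
            if v = i+1 then k else if v = i then i+1
            else if v \<in> X then i else if v \<in> Y then i+1
            else parent F v)
     else if is_parent F (i+1) i then
       let k = parent F (i+1); Y = children F (i+1) - {i}; X = children F i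
       in forest_of_parents n (\<lambda>v.
            if v = i \<or> v = i+1 then k
            else if v \<in> Y then i else if v \<in> X then i+1
            else parent F v)
     else if siblings F i (i+1) then
       let k = parent F i; Y = children F i; X = children F (i+1)
       in forest_of_parents n (\<lambda>v.
            if v = i then k else if v = i+1 then i
            else if v \<in> X then i else if v \<in> Y then i+1
            else parent F v)
     else relabel (id(i := i+1, i+1 := i)) F)"

lemma sigma_not_close:
  "\<not> close F i (i+1) \<Longrightarrow> sigma n i F = relabel (id(i := i+1, i+1 := i)) F"
  by (simp add: sigma_def close_def)


section \<open>Groups given by generators and relations\<close>

text \<open>In a word, \<open>(x, True)\<close> is the generator \<open>x\<close> and \<open>(x, False)\<close> its formal inverse. A pair
  \<open>(u, v)\<close> of words in \<open>R\<close> is the relation \<open>u = v\<close>.\<close>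

type_synonym 'a word = "('a \<times> bool) list"

definition words :: "'a set \<Rightarrow> 'a word set" where
  "words S = lists (S \<times> UNIV)"

inductive_set word_eq :: "'a set \<Rightarrow> ('a word \<times> 'a word) set \<Rightarrow> ('a word \<times> 'a word) set"
  for S R where
  refl: "w \<in> words S \<Longrightarrow> (w, w) \<in> word_eq S R"
| sym: "(u, v) \<in> word_eq S R \<Longrightarrow> (v, u) \<in> word_eq S R"
| trans: "(u, v) \<in> word_eq S R \<Longrightarrow> (v, w) \<in> word_eq S R \<Longrightarrow> (u, w) \<in> word_eq S R"
| cancel: "x \<in> S \<Longrightarrow> a \<in> words S \<Longrightarrow> b \<in> words S \<Longrightarrow>
    (a @ [(x, e), (x, \<not> e)] @ b, a @ b) \<in> word_eq S R"
| rel: "(u, v) \<in> R \<Longrightarrow> u \<in> words S \<Longrightarrow> v \<in> words S \<Longrightarrow> a \<in> words S \<Longrightarrow> b \<in> words S \<Longrightarrow>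
    (a @ u @ b, a @ v @ b) \<in> word_eq S R"

definition presented_group :: "'a set \<Rightarrow> ('a word \<times> 'a word) set \<Rightarrow> 'a word set monoid" where
  "presented_group S R =
     \<lparr>carrier = words S // word_eq S R,
      mult = (\<lambda>A B. \<Union>u \<in> A. \<Union>v \<in> B. word_eq S R `` {u @ v}),
      one = word_eq S R `` {[]}\<rparr>"

definition braid_relations :: "nat \<Rightarrow> (nat word \<times> nat word) set" where
  "braid_relations n =
     {([(i, True), (j, True)], [(j, True), (i, True)]) | i j.
        i \<in> {1..<n} \<and> j \<in> {1..<n} \<and> \<bar>int i - int j\<bar> \<ge> 2} \<union>
     {([(i, True), (i+1, True), (i, True)], [(i+1, True), (i, True), (i+1, True)]) | i.
        i \<in> {1..<n} \<and> i+1 \<in> {1..<n}}"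

definition braid_group :: "nat \<Rightarrow> nat word set monoid" where
  "braid_group n = presented_group {1..<n} (braid_relations n)"

definition braid_gen :: "nat \<Rightarrow> nat \<Rightarrow> nat word set" where
  "braid_gen n i = word_eq {1..<n} (braid_relations n) `` {[(i, True)]}"

end

theory Submission
  imports Defs "HOL-Combinatorics.Transposition"
begin

text \<open>A rooted labeled forest on \<open>n\<close> is the same as a parent function on \<open>{1..n}\<close> with values in
  \<open>{0..n}\<close> that strictly decreases some depth. On parent functions \<open>\<sigma>\<^sub>i\<close> becomes a move that makes
  sense for any two points \<open>a = i\<close>, \<open>b = i + 1\<close>, inspects only the parents of \<open>a\<close> and \<open>b\<close>, and
  changes the other values by the identity or the transposition of \<open>a\<close> and \<open>b\<close>. The braid relations are
  then a finite case distinction on the parents of at most four points. Cases 1, 2, 3 follow one another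
  cyclically and Case 0 is an involution, so \<open>\<sigma>\<^sub>i\<close> has order dividing 6 and is bijective; von Dyck's
  theorem yields the action.\<close>

section \<open>The moves on parent functions\<close>

text \<open>The first branch is Case 1. The second one covers Cases 2, 3 and 0: in Case 0 the parents of \<open>a\<close> and
  \<open>b\<close> are fixed by the transposition, so relabeling the forest exchanges them.\<close>

definition twist :: "'a \<Rightarrow> 'a \<Rightarrow> ('a \<Rightarrow> 'a) \<Rightarrow> 'a \<Rightarrow> 'a" where
  "twist a b p =
    (if p b = a then p(a := b, b := p a)
     else (transpose a b \<circ> p)
       (a := p b, b := if p a = b then p b else if p a = p b then a else p a))"

lemma twist_apply:
  assumes "a \<noteq> b"
  shows "twist a b p a = (if p b = a then b else p b)"
    "twist a b p b =
      (if p b = a then p a else if p a = b then p b else if p a = p b then a else p a)"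
    "v \<noteq> a \<Longrightarrow> v \<noteq> b \<Longrightarrow> twist a b p v = (if p b = a then p v else transpose a b (p v))"
  using assms by (auto simp: twist_def)

text \<open>The last hypothesis singles out Cases 1, 2, 3, and the move leads from 1 to 2, from 2 to
  3 and from 3 to 1. The other values are transposed in Cases 2 and 3 only, hence twice per
  round.\<close>

lemma twist_cube:
  assumes "a \<noteq> b" "p a \<noteq> a" "p b \<noteq> b" "\<not> (p a = b \<and> p b = a)"
    and "p b = a \<or> p a = b \<or> p a = p b"
  shows "twist a b (twist a b (twist a b p)) = p"
  using assms by (auto simp: twist_def fun_eq_iff transpose_def)

text \<open>In Case 0 the parents of \<open>a\<close> and \<open>b\<close> lie outside
  \<open>{a, b}\<close>, so the move is conjugation by the transposition and stays in Case
  0.\<close>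

lemma twist_square:
  assumes "a \<noteq> b" "p a \<noteq> a" "p b \<noteq> b" "\<not> (p b = a \<or> p a = b \<or> p a = p b)"
  shows "twist a b (twist a b p) = p"
  using assms by (auto simp: twist_def fun_eq_iff transpose_def)

text \<open>Each move changes the parents of the other pair by the identity or by a transposition
  that fixes that pair pointwise, so it does not affect which case the other move is in.\<close>

lemma twist_commute:
  assumes "distinct [a, b, c, d]"
    and p: "\<forall>x \<in> {a, b, c, d}. p x \<noteq> x" "\<not> (p a = b \<and> p b = a)" "\<not> (p c = d \<and> p d = c)"
  shows "twist a b (twist c d p) = twist c d (twist a b p)"
proof
  fix v
  have "a \<noteq> b" "a \<noteq> c" "a \<noteq> d" "b \<noteq> c" "b \<noteq> d" "c \<noteq> d"
    using assms(1) by auto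
  then show "twist a b (twist c d p) v = twist c d (twist a b p) v"
    using p
    by (cases "v \<in> {a, b, c, d}") (auto simp: twist_apply transpose_def)
qed

text \<open>Six is a common multiple of the periods 3 and 2, so one exponent serves all
  cases.\<close>

lemma twist_sixth:
  assumes "a \<noteq> b" "p a \<noteq> a" "p b \<noteq> b" "\<not> (p a = b \<and> p b = a)"
  shows "(twist a b ^^ 6) p = p"
  using twist_cube[OF assms] twist_square[OF assms(1-3)]
  by (cases "p b = a \<or> p a = b \<or> p a = p b") (simp_all add: numeral_eq_Suc)

text \<open>The hypotheses are what acyclicity says about three points: no loops, no 2-cycles, and
  no 3-cycles in either orientation.\<close>

lemma twist_braid:
  assumes "distinct [a, b, c]"
    and A: "p a \<noteq> a" "p b \<noteq> b" "p c \<noteq> c"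
    and B: "\<not> (p a = b \<and> p b = a)" "\<not> (p b = c \<and> p c = b)" "\<not> (p a = c \<and> p c = a)"
    and C: "\<not> (p a = b \<and> p b = c \<and> p c = a)" "\<not> (p b = a \<and> p c = b \<and> p a = c)"
  shows "twist a b (twist b c (twist a b p)) = twist b c (twist a b (twist b c p))"
proof -
  from assms(1) have [simp]: "a \<noteq> b" "a \<noteq> c" "b \<noteq> c" "b \<noteq> a" "c \<noteq> a" "c \<noteq> b"
    by auto
  note [simp] = twist_apply
  let ?l = "twist a b (twist b c (twist a b p))" and ?r = "twist b c (twist a b (twist b c p))"
  \<comment> \<open>These alternatives decide every test that the six moves make on the parents of
    \<open>a\<close>, \<open>b\<close>, \<open>c\<close>.\<close>
  have P: "p a = b \<or> p a = c \<or> p a \<noteq> b \<and> p a \<noteq> c"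
    "p b = a \<or> p b = c \<or> p b \<noteq> a \<and> p b \<noteq> c"
    "p c = a \<or> p c = b \<or> p c \<noteq> a \<and> p c \<noteq> b"
    "p a = p b \<or> p a \<noteq> p b" "p b = p c \<or> p b \<noteq> p c" "p a = p c \<or> p a \<noteq> p c"
    by blast+
  have "?l a = ?r a"
    using P(1-4) A B C by (elim disjE conjE; simp)
  moreover have "?l b = ?r b"
    using P A B C by (elim disjE conjE; simp)
  moreover have "?l c = ?r c"
    using P A B C by (elim disjE conjE; simp)
  moreover have "?l v = ?r v" if "v \<noteq> a" "v \<noteq> b" "v \<noteq> c" for v
  proof -
    consider "p v = a" | "p v = b" | "p v = c" | "p v \<noteq> a" "p v \<noteq> b" "p v \<noteq> c" by blast
    then show ?thesis
      using that P(1-4) A B C by cases (elim disjE conjE; simp)+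
  qed
  ultimately have "?l v = ?r v" for v by metis
  then show ?thesis ..
qed

section \<open>Forests and parent functions\<close>

definition adj :: "nat set set \<Rightarrow> (nat \<times> nat) set" where
  "adj E = {(u, v). {u, v} \<in> E}"

lemma sym_adj: "sym (adj E)"
  by (auto simp: adj_def sym_def insert_commute)

lemma is_path_rtrancl: "is_path E vs \<Longrightarrow> (hd vs, last vs) \<in> (adj E)\<^sup>*"
proof (induction vs rule: induct_list012)
  case (3 u v vs)
  then have "(u, v) \<in> adj E" "is_path E (v # vs)"
    by (auto simp: is_path_def adj_def)
  with 3 show ?case by (auto intro: converse_rtrancl_into_rtrancl)
qed (auto simp: is_path_def)

lemma rtrancl_is_path:
  assumes "(u, v) \<in> (adj E)\<^sup>*"
  shows "\<exists>vs. is_path E vs \<and> hd vs = u \<and> last vs = v"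
  using assms
proof (induction rule: converse_rtrancl_induct)
  case base
  show ?case by (rule exI[of _ "[v]"]) (simp add: is_path_def)
next
  case (step u w)
  then obtain vs where vs: "is_path E vs" "hd vs = w" "last vs = v" by blast
  show ?case
  proof (cases "u \<in> set vs")
    \<comment> \<open>Paths have distinct vertices, so a walk that returns to \<open>u\<close> is
      cut down to its part from \<open>u\<close> on.\<close>
    case True
    then obtain xs ys where "vs = xs @ u # ys" by (meson split_list)
    with vs have "is_path E (u # ys)" "last (u # ys) = v"
      by (auto simp: is_path_def successively_append_iff)
    then show ?thesis by (intro exI[of _ "u # ys"]) simp
  next
    case False
    with vs step(1) have "is_path E (u # vs)"
      by (auto simp: is_path_def adj_def successively_Cons)
    with vs show ?thesis by (intro exI[of _ "u # vs"]) (auto simp: is_path_def)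
  qed
qed

lemma component_eq: "component V E v = {w \<in> V. (v, w) \<in> (adj E)\<^sup>*}"
  unfolding component_def using is_path_rtrancl rtrancl_is_path by blast

text \<open>The function \<open>d\<close> witnesses acyclicity.\<close>

locale parent_function =
  fixes n :: nat and p d :: "nat \<Rightarrow> nat"
  assumes outside: "v \<notin> {1..n} \<Longrightarrow> p v = 0"
    and le: "p v \<le> n"
    and less: "v \<in> {1..n} \<Longrightarrow> d (p v) < d v"
begin

lemma p_neq: assumes "v \<in> {1..n}" shows "p v \<noteq> v"
  using less[OF assms] by auto

lemma no_2_cycle: assumes "u \<in> {1..n}" "v \<in> {1..n}" shows "\<not> (p u = v \<and> p v = u)"
  using less[OF assms(1)] less[OF assms(2)] by auto

lemma no_3_cycle:
  assumes "u \<in> {1..n}" "v \<in> {1..n}" "w \<in> {1..n}"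
  shows "\<not> (p u = v \<and> p v = w \<and> p w = u)"
  using less[OF assms(1)] less[OF assms(2)] less[OF assms(3)] by auto

section \<open>From parent functions to rooted forests\<close>

lemma in_edges:
  "{u, w} \<in> edges (forest_of_parents n p) \<longleftrightarrow>
    u \<in> {1..n} \<and> p u \<noteq> 0 \<and> w = p u \<or> w \<in> {1..n} \<and> p w \<noteq> 0 \<and> u = p w"
  by (auto simp: forest_of_parents_def doubleton_eq_iff)

text \<open>Since \<open>p\<close> is 0 at the roots, the edges to the master root have the same
  form \<open>{v, p v}\<close> as all others.\<close>

lemma in_plus_edges:
  "{u, w} \<in> plus_edges (forest_of_parents n p) \<longleftrightarrow>
    u \<in> {1..n} \<and> w = p u \<or> w \<in> {1..n} \<and> u = p w"
  unfolding plus_edges_def Un_iff in_edges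
  by (auto simp: forest_of_parents_def doubleton_eq_iff)

text \<open>A deepest vertex of a cycle can only have its parent as a neighbor there, yet its two
  neighbors on the cycle are distinct.\<close>

lemma acyclic: "acyclic_graph (edges (forest_of_parents n p))"
  unfolding acyclic_graph_def
proof
  let ?E = "edges (forest_of_parents n p)"
  assume "\<exists>vs. is_path ?E vs \<and> length vs \<ge> 3 \<and> {last vs, hd vs} \<in> ?E"
  then obtain vs where vs: "is_path ?E vs" "length vs \<ge> 3" "{last vs, hd vs} \<in> ?E" by blast
  define L where "L = length vs"
  \<comment> \<open>Periodic indexing treats the closing edge like every other edge.\<close>
  define f where "f m = vs ! (m mod L)" for m
  have L: "L \<ge> 3" using vs by (simp add: L_def)
  have step: "{f m, f (Suc m)} \<in> ?E" for m
  proof (cases "Suc (m mod L) = L")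
    case True
    then have "m mod L = L - 1" "Suc m mod L = 0" by (simp_all add: mod_Suc)
    moreover have "vs \<noteq> []" using L by (auto simp: L_def)
    ultimately have "f m = last vs" "f (Suc m) = hd vs"
      by (simp_all add: f_def L_def last_conv_nth hd_conv_nth)
    with vs show ?thesis by simp
  next
    case False
    then have "Suc (m mod L) < L" using L by (metis Suc_lessI mod_less_divisor zero_less_numeral order_less_le_trans)
    with False vs show ?thesis
      by (auto simp: f_def is_path_def successively_conv_nth L_def mod_Suc)
  qed
  have inj: "m mod L = m' mod L" if "f m = f m'" for m m'
    using that vs(1) L by (auto simp: f_def is_path_def L_def nth_eq_iff_index_eq)
  have "set vs \<noteq> {}" using L by (auto simp: L_def)
  then have "Max (d ` set vs) \<in> d ` set vs" by (intro Max_in) auto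
  then obtain v where v: "v \<in> set vs" "d v = Max (d ` set vs)" by auto
  then have max: "d w \<le> d v" if "w \<in> set vs" for w using that by simp
  from v(1) obtain m where "m < L" "v = vs ! m" by (auto simp: in_set_conv_nth L_def)
  \<comment> \<open>The shift by \<open>L\<close> gives position 0 a predecessor as well.\<close>
  then have m: "m < L" "v = f (m + L)" by (simp_all add: f_def)
  have up: "w = p v" if "w \<in> set vs" "{v, w} \<in> ?E" for w
    using that max[of w] less[of w] by (auto simp: in_edges)
  have fs: "f k \<in> set vs" for k
  proof -
    have "k mod L < length vs" using L by (simp add: L_def[symmetric])
    then show ?thesis by (simp add: f_def)
  qed
  have "f (Suc (m + L)) = p v" using step[of "m + L"] m by (intro up fs) simp
  moreover have "f (m + L - 1) = p v"
    using step[of "m + L - 1"] m L by (intro up fs) (simp add: insert_commute)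
  ultimately have "Suc (m + L) mod L = (m + L - 1) mod L" using inj by metis
  then have "L dvd Suc (m + L) - (m + L - 1)" by (subst (asm) mod_eq_dvd_iff_nat) auto
  moreover have "Suc (m + L) - (m + L - 1) = 2" using L by simp
  ultimately have "L \<le> 2" by (auto dest: dvd_imp_le)
  with L show False by simp
qed

definition up :: "(nat \<times> nat) set" where
  "up = {(v, p v) | v. v \<in> {1..n} \<and> p v \<noteq> 0}"

lemma adj_edges: "adj (edges (forest_of_parents n p)) = up \<union> up\<inverse>"
  by (auto simp: adj_def in_edges up_def)

lemma root_reachable:
  assumes "v \<in> {1..n}"
  shows "\<exists>r \<in> roots (forest_of_parents n p). (v, r) \<in> up\<^sup>*"
  using assms
proof (induction "d v" arbitrary: v rule: less_induct)
  case less
  show ?case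
  proof (cases "p v = 0")
    case True
    with less.prems show ?thesis by (auto simp: forest_of_parents_def)
  next
    case False
    with less.prems have "(v, p v) \<in> up" "p v \<in> {1..n}" "d (p v) < d v"
      using le[of v] parent_function.less[OF parent_function_axioms] by (auto simp: up_def)
    with less.hyps show ?thesis by (meson converse_rtrancl_into_rtrancl)
  qed
qed

lemma up_root:
  assumes "(v, r) \<in> (adj (edges (forest_of_parents n p)))\<^sup>*" "r \<in> roots (forest_of_parents n p)"
  shows "(v, r) \<in> up\<^sup>*"
  using assms(1)
proof (induction rule: converse_rtrancl_induct)
  case (step u w)
  then consider "(u, w) \<in> up" | "(w, u) \<in> up" by (auto simp: adj_edges)
  then show ?case
  proof cases
    case 2
    with assms(2) have "w \<noteq> r" by (auto simp: up_def forest_of_parents_def)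
    with step obtain x where "(w, x) \<in> up" "(x, r) \<in> up\<^sup>*" by (meson converse_rtranclE)
    with 2 show ?thesis by (auto simp: up_def)
  qed (use step in auto)
qed simp

text \<open>Upward steps are deterministic, so one of the two paths extends the other, and no upward
  step leaves a root.\<close>

lemma root_unique:
  assumes "(v, r) \<in> up\<^sup>*" "(v, r') \<in> up\<^sup>*"
    and "r \<in> roots (forest_of_parents n p)" "r' \<in> roots (forest_of_parents n p)"
  shows "r = r'"
proof -
  have no: "(s, x) \<notin> up" if "s \<in> roots (forest_of_parents n p)" for s x
    using that by (auto simp: up_def forest_of_parents_def)
  have stuck: "x = s" if "(s, x) \<in> up\<^sup>*" "s \<in> roots (forest_of_parents n p)" for s x
    using that(1) no[OF that(2)] by (cases rule: converse_rtranclE) auto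
  have "single_valued up" by (auto simp: single_valued_def up_def)
  from single_valued_confluent[OF this assms(1,2)] show ?thesis
    using stuck assms(3,4) by blast
qed

lemma in_rooted_forests: "forest_of_parents n p \<in> rooted_forests n"
proof -
  let ?F = "forest_of_parents n p"
  have r: "roots ?F \<subseteq> {1..n}" by (auto simp: forest_of_parents_def)
  have sub: "v \<noteq> p v" if "v \<in> {1..n}" for v using less[OF that] by auto
  have "edges ?F \<subseteq> {{u, v} | u v. u \<in> {1..n} \<and> v \<in> {1..n} \<and> u \<noteq> v}"
  proof
    fix e assume "e \<in> edges ?F"
    then obtain v where "e = {v, p v}" "v \<in> {1..n}" "p v \<noteq> 0" by (auto simp: forest_of_parents_def)
    with sub le[of v] show "e \<in> {{u, v} | u v. u \<in> {1..n} \<and> v \<in> {1..n} \<and> u \<noteq> v}"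
      by (intro CollectI exI[of _ v] exI[of _ "p v"]) auto
  qed
  moreover have "\<exists>!r. r \<in> roots ?F \<inter> component {1..n} (edges ?F) v" if v: "v \<in> {1..n}" for v
  proof -
    obtain r where "r \<in> roots ?F" "(v, r) \<in> up\<^sup>*" using root_reachable[OF v] by blast
    moreover from this have "(v, r) \<in> (adj (edges ?F))\<^sup>*"
      unfolding adj_edges using in_rtrancl_UnI by blast
    ultimately show ?thesis
      using r by (intro ex1I[of _ r]) (auto simp: component_eq intro: root_unique up_root)
  qed
  ultimately show ?thesis using r acyclic by (auto simp: rooted_forests_def)
qed

text \<open>A path to 0 never descends: after a step from \<open>u\<close> down to its child
  \<open>w\<close>, the remaining path climbs from \<open>w\<close> and would visit \<open>u\<close>
  again.\<close>

lemma path_up: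
  assumes "is_path (plus_edges (forest_of_parents n p)) vs" "last vs = 0"
  shows "successively (\<lambda>u w. u \<in> {1..n} \<and> w = p u) vs"
  using assms
proof (induction vs rule: induct_list012)
  case (3 u w vs)
  then have IH: "successively (\<lambda>u w. u \<in> {1..n} \<and> w = p u) (w # vs)"
    and uw: "{u, w} \<in> plus_edges (forest_of_parents n p)" "u \<notin> set (w # vs)"
    by (auto simp: is_path_def)
  have "\<not> (w \<in> {1..n} \<and> u = p w)"
    using IH uw(2) 3(4) by (cases vs) auto
  with IH uw(1) show ?case by (auto simp: in_plus_edges)
qed (auto simp: is_path_def)

text \<open>The depth bound is carried through the induction to show that prepending
  \<open>v\<close> keeps the vertices distinct.\<close>

lemma path_to_0:
  assumes "v \<le> n"
  shows "\<exists>vs. is_path (plus_edges (forest_of_parents n p)) (v # vs) \<and> last (v # vs) = 0 \<and>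
    (\<forall>w \<in> set (v # vs). d w \<le> d v) \<and> (v \<in> {1..n} \<longrightarrow> vs \<noteq> [] \<and> hd vs = p v)"
  using assms
proof (induction "d v" arbitrary: v rule: less_induct)
  case less
  show ?case
  proof (cases "v = 0")
    case True
    then show ?thesis by (intro exI[of _ "[]"]) (simp add: is_path_def)
  next
    case False
    with less.prems have v: "v \<in> {1..n}" by auto
    then have d: "d (p v) < d v" by (rule parent_function.less[OF parent_function_axioms])
    from less.hyps[OF d le] obtain vs where
      vs: "is_path (plus_edges (forest_of_parents n p)) (p v # vs)" "last (p v # vs) = 0"
        "\<forall>w \<in> set (p v # vs). d w \<le> d (p v)" by blast
    with d have "v \<notin> set (p v # vs)" by fastforce
    moreover have "{v, p v} \<in> plus_edges (forest_of_parents n p)" using v by (simp add: in_plus_edges)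
    ultimately show ?thesis using vs d
      by (intro exI[of _ "p v # vs"]) (auto simp: is_path_def)
  qed
qed

text \<open>Any path to 0 starts with the step to \<open>p v\<close> by \<open>path_up\<close>, and
  \<open>path_to_0\<close> supplies such a path.\<close>

lemma is_parent_iff: "is_parent (forest_of_parents n p) u v \<longleftrightarrow> v \<in> {1..n} \<and> u = p v"
proof
  assume "is_parent (forest_of_parents n p) u v"
  then show "v \<in> {1..n} \<and> u = p v"
    unfolding is_parent_def using path_up by fastforce
next
  assume v: "v \<in> {1..n} \<and> u = p v"
  with path_to_0[of v] obtain vs where
    "is_path (plus_edges (forest_of_parents n p)) (v # vs)" "last (v # vs) = 0" "vs \<noteq> []" "hd vs = p v"
    by auto
  with v show "is_parent (forest_of_parents n p) u v"
    unfolding is_parent_def by (intro exI[of _ "tl vs"]) (cases vs; auto)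
qed

lemma parent_eq: "v \<in> {1..n} \<Longrightarrow> parent (forest_of_parents n p) v = p v"
  by (simp add: parent_def is_parent_iff)

lemma children_eq: "children (forest_of_parents n p) u = {v \<in> {1..n}. p v = u}"
  by (auto simp: children_def is_parent_iff)

end

section \<open>From rooted forests to parent functions\<close>

lemma rooted_forest_obtain_parents:
  assumes F: "F \<in> rooted_forests n"
  obtains p d where "parent_function n p d" "F = forest_of_parents n p"
proof -
  define A where "A = adj (plus_edges F)"
  \<comment> \<open>This is the distance to the master root in \<open>F\<^sub>+\<close>;
    \<open>p\<close> then picks some neighbor that is nearer.\<close>
  define d where "d v = (LEAST k. (v, 0) \<in> A ^^ k)" for v
  define p where "p v = (if v \<in> {1..n} then SOME u. (v, u) \<in> A \<and> d u < d v else 0)" for v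
  have E: "u \<in> {1..n} \<and> v \<in> {1..n} \<and> u \<noteq> v" if "{u, v} \<in> edges F" for u v
  proof -
    have "{u, v} \<in> {{u, v} | u v. u \<in> {1..n} \<and> v \<in> {1..n} \<and> u \<noteq> v}"
      using F that by (auto simp: rooted_forests_def)
    then show ?thesis by (auto simp: doubleton_eq_iff)
  qed
  have roots: "roots F \<subseteq> {1..n}" using F by (simp add: rooted_forests_def)
  have root: "\<exists>!r. r \<in> roots F \<inter> component {1..n} (edges F) v" if "v \<in> {1..n}" for v
    using F that by (simp add: rooted_forests_def)
  have A: "(u, v) \<in> A \<longleftrightarrow> {u, v} \<in> edges F \<or> u = 0 \<and> v \<in> roots F \<or> v = 0 \<and> u \<in> roots F" for u v
    by (auto simp: A_def adj_def plus_edges_def doubleton_eq_iff)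
  have ex: "\<exists>k. (v, 0) \<in> A ^^ k" if v: "v \<in> {1..n}" for v
  proof -
    obtain r where r: "r \<in> roots F" "(v, r) \<in> (adj (edges F))\<^sup>*"
      using root[OF v] unfolding component_eq by blast
    moreover have "adj (edges F) \<subseteq> A" by (auto simp: A adj_def)
    ultimately have "(v, r) \<in> A\<^sup>*" using rtrancl_mono by blast
    moreover have "(r, 0) \<in> A" using r A by blast
    ultimately have "(v, 0) \<in> A\<^sup>*" by (rule rtrancl_into_rtrancl)
    then show ?thesis by (simp add: rtrancl_power)
  qed
  \<comment> \<open>The second vertex of a shortest walk to 0 is a nearer neighbor.\<close>
  have p: "(v, p v) \<in> A \<and> d (p v) < d v" if v: "v \<in> {1..n}" for v
  proof -
    have dv: "(v, 0) \<in> A ^^ d v" unfolding d_def using ex[OF v] by (rule LeastI_ex)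
    with v obtain k where k: "d v = Suc k" by (cases "d v") auto
    with dv obtain u where u: "(v, u) \<in> A" "(u, 0) \<in> A ^^ k" by (metis relpow_Suc_D2)
    from u(2) have "d u \<le> k" unfolding d_def by (rule Least_le)
    with u k have "\<exists>u. (v, u) \<in> A \<and> d u < d v" by auto
    then show ?thesis using v unfolding p_def by simp (rule someI_ex)
  qed
  have le: "p v \<le> n" for v
  proof (cases "v \<in> {1..n}")
    case True
    with p have "(v, p v) \<in> A" by blast
    then show ?thesis using E roots by (auto simp: A)
  qed (auto simp: p_def)
  interpret parent_function n p d
    using p le by unfold_locales (auto simp: p_def)
  let ?F = "forest_of_parents n p"
  have "p r = 0" if r: "r \<in> roots F" for r
  proof -
    have "(r, 0) \<in> A ^^ 1" using r by (simp add: A)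
    then have "d r \<le> 1" unfolding d_def by (rule Least_le)
    moreover have rn: "r \<in> {1..n}" using r roots by blast
    ultimately have "d (p r) = 0" using p[OF rn] by simp
    \<comment> \<open>A least length 0 forces the vertex 0 once some walk exists, which
      \<open>ex\<close> provides on \<open>{1..n}\<close>; outside, the bound on \<open>p\<close>
      leaves only 0.\<close>
    show ?thesis
    proof (cases "p r \<in> {1..n}")
      case True
      from LeastI_ex[OF ex[OF True]] have "(p r, 0) \<in> A ^^ d (p r)" by (simp add: d_def)
      with \<open>d (p r) = 0\<close> show ?thesis by simp
    qed (use le[of r] in auto)
  qed
  moreover have "v \<in> roots F" if "v \<in> {1..n}" "p v = 0" for v
    using p[OF that(1)] that E[of v 0] by (auto simp: A)
  ultimately have roots_eq: "roots ?F = roots F" using roots by (auto simp: forest_of_parents_def)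
  have sub: "edges ?F \<subseteq> edges F"
    using p by (fastforce simp: forest_of_parents_def A)
  \<comment> \<open>The ends of a missing edge climb to roots in the same component of
    \<open>F\<close>, hence to the same root. They are thus joined by a path of parent edges, and
    the missing edge closes it to a cycle of \<open>F\<close>.\<close>
  have "edges F \<subseteq> edges ?F"
  proof
    fix e assume e: "e \<in> edges F"
    then obtain u v where uv: "e = {u, v}"
      using F by (auto simp: rooted_forests_def)
    show "e \<in> edges ?F"
    proof (rule ccontr)
      assume ne: "e \<notin> edges ?F"
      have n: "u \<in> {1..n}" "v \<in> {1..n}" "u \<noteq> v" using E e uv by auto
      obtain r s where r: "r \<in> roots F" "(u, r) \<in> up\<^sup>*" and s: "s \<in> roots F" "(v, s) \<in> up\<^sup>*"
        using root_reachable n roots_eq by metis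
      have "up \<subseteq> adj (edges F)" using sub adj_edges by (auto simp: adj_def)
      then have "up\<^sup>* \<subseteq> (adj (edges F))\<^sup>*" by (rule rtrancl_mono)
      moreover have "(u, v) \<in> adj (edges F)" using e uv by (simp add: adj_def)
      ultimately have "(u, r) \<in> (adj (edges F))\<^sup>*" "(u, s) \<in> (adj (edges F))\<^sup>*"
        using r s by (blast intro: converse_rtrancl_into_rtrancl)+
      with root[OF n(1)] r s roots have "r = s" unfolding component_eq by blast
      have "up\<^sup>* \<subseteq> (adj (edges ?F))\<^sup>*" by (intro rtrancl_mono) (simp add: adj_edges)
      with r s \<open>r = s\<close> have "(u, r) \<in> (adj (edges ?F))\<^sup>*" "(v, r) \<in> (adj (edges ?F))\<^sup>*"
        by auto
      then have "(u, v) \<in> (adj (edges ?F))\<^sup>*"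
        by (meson sym_adj sym_rtrancl symD rtrancl_trans)
      then obtain vs where vs: "is_path (edges ?F) vs" "hd vs = u" "last vs = v"
        using rtrancl_is_path by blast
      then obtain ws where ws: "vs = u # ws" by (cases vs) (auto simp: is_path_def)
      with vs n obtain w ws' where ws': "ws = w # ws'" by (cases ws) auto
      \<comment> \<open>A path with a single edge would be the missing edge itself.\<close>
      have "ws' \<noteq> []"
      proof
        assume "ws' = []"
        then have "vs = [u, v]" using vs ws ws' by simp
        with vs(1) ne uv show False by (simp add: is_path_def)
      qed
      then have "length vs \<ge> 3" using ws ws' by (cases ws') auto
      moreover have "is_path (edges F) vs"
        using vs(1) sub unfolding is_path_def by (auto elim: successively_mono)
      moreover have "{last vs, hd vs} \<in> edges F" using vs e uv by (simp add: insert_commute)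
      ultimately show False using F by (auto simp: rooted_forests_def acyclic_graph_def)
    qed
  qed
  with sub roots_eq have "F = ?F" by auto
  with that parent_function_axioms show thesis by blast
qed

section \<open>The operators in terms of parent functions\<close>

lemma forest_of_parents_cong:
  assumes eq: "\<And>v. v \<in> {1..n} \<Longrightarrow> p v = q v"
  shows "forest_of_parents n p = forest_of_parents n q"
proof -
  have "e = {v, p v} \<and> v \<in> {1..n} \<and> p v \<noteq> 0 \<longleftrightarrow> e = {v, q v} \<and> v \<in> {1..n} \<and> q v \<noteq> 0" for e v
    using eq[of v] by (cases "v \<in> {1..n}") auto
  moreover have "v \<in> {1..n} \<and> p v = 0 \<longleftrightarrow> v \<in> {1..n} \<and> q v = 0" for v
    using eq[of v] by (cases "v \<in> {1..n}") auto
  ultimately show ?thesis by (simp only: forest_of_parents_def)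
qed

lemma relabel_forest_of_parents:
  assumes f: "bij_betw f {1..n} {1..n}" "f 0 = 0" and p: "\<And>v. p v \<le> n"
    and g: "\<And>v. v \<in> {1..n} \<Longrightarrow> g (f v) = v"
  shows "relabel f (forest_of_parents n p) = forest_of_parents n (f \<circ> p \<circ> g)"
proof -
  have im: "f ` {1..n} = {1..n}" using f(1) by (simp add: bij_betw_def)
  \<comment> \<open>Hence relabeling preserves which vertices are roots and which carry an edge to a
    parent.\<close>
  have f0: "f u = 0 \<longleftrightarrow> u = 0" if "u \<le> n" for u
  proof (cases "u = 0")
    case False
    with that im have "f u \<in> {1..n}" by (metis One_nat_def atLeastAtMost_iff imageI less_one not_less)
    with False show ?thesis by auto
  qed (simp add: f)
  let ?E = "\<lambda>v. {f v, f (p v)}"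
  have "(`) f ` edges (forest_of_parents n p) = ?E ` {v \<in> {1..n}. p v \<noteq> 0}"
    by (simp add: forest_of_parents_def setcompr_eq_image image_image)
  also have "\<dots> = (\<lambda>w. {w, f (p (g w))}) ` f ` {v \<in> {1..n}. p v \<noteq> 0}"
    unfolding image_image using g by (intro image_cong refl) auto
  also have "f ` {v \<in> {1..n}. p v \<noteq> 0} = {w \<in> f ` {1..n}. f (p (g w)) \<noteq> 0}"
    using g f0[OF p] by auto
  also have "(\<lambda>w. {w, f (p (g w))}) ` \<dots> = edges (forest_of_parents n (f \<circ> p \<circ> g))"
    unfolding im by (auto simp: forest_of_parents_def)
  finally have "(`) f ` edges (forest_of_parents n p) = edges (forest_of_parents n (f \<circ> p \<circ> g))" .
  moreover have "f ` roots (forest_of_parents n p) = {w \<in> f ` {1..n}. f (p (g w)) = 0}"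
    using g f0[OF p] by (auto simp: forest_of_parents_def)
  then have "f ` roots (forest_of_parents n p) = roots (forest_of_parents n (f \<circ> p \<circ> g))"
    unfolding im by (simp add: forest_of_parents_def)
  ultimately show ?thesis by (simp add: relabel_def)
qed

context parent_function
begin

text \<open>All notions in \<open>sigma\<close> turn into conditions on \<open>p\<close>. The parent
  functions are compared on \<open>{1..n}\<close> only, because \<open>parent\<close> is unspecified
  elsewhere.\<close>

lemma sigma_eq_twist:
  assumes "i \<in> {1..<n}"
  shows "sigma n i (forest_of_parents n p) = forest_of_parents n (twist i (i + 1) p)"
proof -
  have i: "i \<in> {1..n}" "i + 1 \<in> {1..n}" "i \<noteq> i + 1" using assms by auto
  let ?t = "transpose i (i + 1)"
  have cyc: "\<not> (p i = i + 1 \<and> p (i + 1) = i)" using less[OF i(1)] less[OF i(2)] by auto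
  have irr: "p i \<noteq> i" "p (i + 1) \<noteq> i + 1" using less[OF i(1)] less[OF i(2)] by auto
  have sib: "siblings (forest_of_parents n p) i (i + 1) \<longleftrightarrow> p i = p (i + 1)"
    using i by (auto simp: siblings_def is_parent_iff)
  have swap: "id(i := i + 1, i + 1 := i) = ?t" by (auto simp: fun_eq_iff transpose_def)
  have rel: "relabel ?t (forest_of_parents n p) = forest_of_parents n (?t \<circ> p \<circ> ?t)"
    using i le by (intro relabel_forest_of_parents) (auto intro!: bij_betw_byWitness[where f' = ?t] simp: transpose_def)
  note simps = sigma_def is_parent_iff sib parent_eq[OF i(1)] parent_eq[OF i(2)] children_eq Let_def
  consider "p (i + 1) = i" | "p (i + 1) \<noteq> i" "p i = i + 1"
    | "p (i + 1) \<noteq> i" "p i \<noteq> i + 1" "p i = p (i + 1)"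
    | "p (i + 1) \<noteq> i" "p i \<noteq> i + 1" "p i \<noteq> p (i + 1)" by blast
  then show ?thesis
  proof cases
    case 1
    with i cyc show ?thesis
      unfolding simps
      by simp (intro forest_of_parents_cong, auto simp: twist_apply parent_eq)
  next
    case 2
    with i cyc show ?thesis
      unfolding simps
      by simp (intro forest_of_parents_cong, auto simp: twist_apply parent_eq transpose_def)
  next
    case 3
    with i cyc irr show ?thesis
      unfolding simps
      by simp (intro forest_of_parents_cong, auto simp: twist_apply parent_eq transpose_def)
  next
    case 4
    with i cyc irr show ?thesis
      unfolding simps swap rel
      by simp (intro forest_of_parents_cong, auto simp: twist_apply transpose_def)
  qed
qed

text \<open>Acyclicity survives because each case admits an explicit new depth; doubling the old one
  makes room for inserted levels.\<close>

lemma parent_function_twist: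
  assumes a: "a \<in> {1..n}" and b: "b \<in> {1..n}" and ab: "a \<noteq> b"
  shows "\<exists>d'. parent_function n (twist a b p) d'"
proof -
  have tn: "transpose a b v \<le> n" if "v \<le> n" for v using that a b by (auto simp: transpose_def)
  have out: "twist a b p v = 0" if "v \<notin> {1..n}" for v
    using that a b ab outside[OF that] by (auto simp: twist_apply transpose_def)
  have bound: "twist a b p v \<le> n" for v
    using le tn a b ab
    by (cases "v = a"; cases "v = b") (auto simp: twist_apply)
  note la = less[OF a] and lb = less[OF b]
  have *: ?thesis if "\<And>v. v \<in> {1..n} \<Longrightarrow> d' (twist a b p v) < d' v" for d' :: "nat \<Rightarrow> nat"
    using out bound that by (intro exI[of _ d'] parent_function.intro) simp_all
  consider "p b = a" | "p b \<noteq> a" "p a = b" | "p b \<noteq> a" "p a \<noteq> b" "p a = p b"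
    | "p b \<noteq> a" "p a \<noteq> b" "p a \<noteq> p b" by blast
  then show ?thesis
  proof cases
    case 1
    \<comment> \<open>Now \<open>b\<close> occupies the old level of \<open>a\<close>, and the odd
      value fits \<open>a\<close> between \<open>b\<close> and all their other children.\<close>
    let ?d = "(\<lambda>v. 2 * d v)(a := 2 * d a + 1, b := 2 * d a)"
    show ?thesis
    proof (rule *)
      fix v assume "v \<in> {1..n}"
      from less[OF this] 1 la lb ab show "?d (twist a b p v) < ?d v"
        by (cases "v = a"; cases "v = b") (auto simp: twist_apply)
    qed
  next
    case 2
    \<comment> \<open>Now \<open>a\<close> is a sibling of \<open>b\<close>, and all the children
      they exchange are deeper than \<open>b\<close> was.\<close>
    let ?d = "d(a := d b)"
    show ?thesis
    proof (rule *)
      fix v assume "v \<in> {1..n}"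
      from less[OF this] 2 la lb ab show "?d (twist a b p v) < ?d v"
        by (cases "v = a"; cases "v = b") (auto simp: twist_apply transpose_def)
    qed
  next
    case 3
    \<comment> \<open>The children of \<open>a\<close> and \<open>b\<close> have doubled depth at
      least \<open>2 * d (p a) + 4\<close>, above both new values.\<close>
    let ?d = "(\<lambda>v. 2 * d v)(a := 2 * d (p a) + 1, b := 2 * d (p a) + 2)"
    show ?thesis
    proof (rule *)
      fix v assume "v \<in> {1..n}"
      from less[OF this] 3 la lb ab show "?d (twist a b p v) < ?d v"
        by (cases "v = a"; cases "v = b") (auto simp: twist_apply transpose_def)
    qed
  next
    case 4
    let ?d = "d \<circ> transpose a b"
    show ?thesis
    proof (rule *)
      fix v assume "v \<in> {1..n}"
      from less[OF this] 4 la lb ab show "?d (twist a b p v) < ?d v"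
        by (cases "v = a"; cases "v = b") (auto simp: twist_apply transpose_def)
    qed
  qed
qed

end

section \<open>Presented groups\<close>

lemma word_eq_words: "(u, v) \<in> word_eq S R \<Longrightarrow> u \<in> words S \<and> v \<in> words S"
  by (induction rule: word_eq.induct) (auto simp: words_def)

lemma equiv_word_eq: "equiv (words S) (word_eq S R)"
proof (rule equivI)
  show "word_eq S R \<subseteq> words S \<times> words S" by (auto dest: word_eq_words)
  show "refl_on (words S) (word_eq S R)"
    by (auto simp: refl_on_def intro: word_eq.refl)
  show "sym (word_eq S R)" by (auto intro: symI word_eq.sym)
  show "trans (word_eq S R)" by (blast intro: transI word_eq.trans)
qed

text \<open>The rules \<open>cancel\<close> and \<open>rel\<close> already carry a context, which
  absorbs a further one.\<close>

lemma word_eq_context: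
  assumes "(u, v) \<in> word_eq S R" "a \<in> words S" "b \<in> words S"
  shows "(a @ u @ b, a @ v @ b) \<in> word_eq S R"
  using assms(1)
proof (induction rule: word_eq.induct)
  case (refl w)
  then show ?case using assms by (auto simp: words_def intro: word_eq.refl)
next
  case (cancel x c c' e)
  then have "((a @ c) @ [(x, e), (x, \<not> e)] @ (c' @ b), (a @ c) @ (c' @ b)) \<in> word_eq S R"
    using assms by (intro word_eq.cancel) (auto simp: words_def)
  then show ?case by simp
next
  case (rel u v c c')
  then have "((a @ c) @ u @ (c' @ b), (a @ c) @ v @ (c' @ b)) \<in> word_eq S R"
    using assms by (intro word_eq.rel) (auto simp: words_def)
  then show ?case by simp
qed (blast intro: word_eq.sym word_eq.trans)+

lemma word_eq_append:
  assumes "(u, u') \<in> word_eq S R" "(v, v') \<in> word_eq S R"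
  shows "(u @ v, u' @ v') \<in> word_eq S R"
proof -
  have w: "u' \<in> words S" "v \<in> words S" "[] \<in> words S"
    using assms[THEN word_eq_words] by (auto simp: words_def)
  show ?thesis
    using word_eq_context[OF assms(1) w(3,2)] word_eq_context[OF assms(2) w(1,3)]
    by (auto intro: word_eq.trans)
qed

definition inv_word :: "'a word \<Rightarrow> 'a word" where
  "inv_word w = rev (map (\<lambda>(x, e). (x, \<not> e)) w)"

lemma inv_word_words: "w \<in> words S \<Longrightarrow> inv_word w \<in> words S"
  by (auto simp: words_def inv_word_def)

text \<open>The first letter of the word and its formal inverse meet in the middle and
  cancel.\<close>

lemma inv_word_append:
  "w \<in> words S \<Longrightarrow> (inv_word w @ w, []) \<in> word_eq S R"
proof (induction w)
  case Nil
  then show ?case by (auto simp: inv_word_def intro: word_eq.refl)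
next
  case (Cons y w)
  obtain x e where y: "y = (x, e)" by fastforce
  with Cons have w: "x \<in> S" "w \<in> words S" by (auto simp: words_def)
  then have "(inv_word w @ [(x, \<not> e), (x, \<not> \<not> e)] @ w, inv_word w @ w) \<in> word_eq S R"
    by (intro word_eq.cancel inv_word_words)
  with Cons.IH w show ?case by (auto simp: y inv_word_def intro: word_eq.trans)
qed

text \<open>By the congruence property all sets in the defining union coincide, and by reflexivity
  the union is not empty.\<close>

lemma class_mult:
  assumes "u \<in> words S" "v \<in> words S"
  shows "(word_eq S R `` {u}) \<otimes>\<^bsub>presented_group S R\<^esub> (word_eq S R `` {v}) = word_eq S R `` {u @ v}"
proof -
  let ?c = "\<lambda>w. word_eq S R `` {w}"
  have c: "?c (u' @ v') = ?c (u @ v)"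
    if "(u, u') \<in> word_eq S R" "(v, v') \<in> word_eq S R" for u' v'
    using word_eq_append[OF that] by (metis equiv_class_eq equiv_word_eq)
  have "(\<Union>u' \<in> ?c u. \<Union>v' \<in> ?c v. ?c (u' @ v')) = (\<Union>u' \<in> ?c u. \<Union>v' \<in> ?c v. ?c (u @ v))"
    by (intro SUP_cong refl c) simp_all
  also have "\<dots> = ?c (u @ v)"
    using assms by (auto intro: word_eq.refl)
  finally show ?thesis by (simp add: presented_group_def)
qed

lemma class_carrier: "u \<in> words S \<Longrightarrow> word_eq S R `` {u} \<in> carrier (presented_group S R)"
  by (simp add: presented_group_def quotientI)

lemma class_cases:
  assumes "A \<in> carrier (presented_group S R)"
  obtains u where "u \<in> words S" "A = word_eq S R `` {u}"
  using assms by (auto simp: presented_group_def elim: quotientE)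

lemma class_one: "\<one>\<^bsub>presented_group S R\<^esub> = word_eq S R `` {[]}"
  by (simp add: presented_group_def)

lemma group_presented_group: "group (presented_group S R)"
proof (rule groupI)
  have app: "u @ v \<in> words S" if "u \<in> words S" "v \<in> words S" for u v
    using that by (auto simp: words_def)
  have nil: "[] \<in> words S" by (simp add: words_def)
  let ?G = "presented_group S R"
  show "x \<otimes>\<^bsub>?G\<^esub> y \<in> carrier ?G" if "x \<in> carrier ?G" "y \<in> carrier ?G" for x y
    using that by (auto elim!: class_cases simp: class_mult class_carrier app)
  show "\<one>\<^bsub>?G\<^esub> \<in> carrier ?G" by (simp add: class_one class_carrier nil)
  show "x \<otimes>\<^bsub>?G\<^esub> y \<otimes>\<^bsub>?G\<^esub> z = x \<otimes>\<^bsub>?G\<^esub> (y \<otimes>\<^bsub>?G\<^esub> z)"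
    if "x \<in> carrier ?G" "y \<in> carrier ?G" "z \<in> carrier ?G" for x y z
    using that by (auto elim!: class_cases simp: class_mult app)
  show "\<one>\<^bsub>?G\<^esub> \<otimes>\<^bsub>?G\<^esub> x = x" if "x \<in> carrier ?G" for x
    using that by (auto elim!: class_cases simp: class_mult class_one nil)
  show "\<exists>y\<in>carrier ?G. y \<otimes>\<^bsub>?G\<^esub> x = \<one>\<^bsub>?G\<^esub>" if x: "x \<in> carrier ?G" for x
  proof -
    obtain u where u: "u \<in> words S" "x = word_eq S R `` {u}"
      using class_cases[OF x] by blast
    then have "word_eq S R `` {inv_word u} \<otimes>\<^bsub>?G\<^esub> x = \<one>\<^bsub>?G\<^esub>"
      using inv_word_append[OF u(1)]
      by (simp add: class_mult class_one inv_word_words equiv_class_eq[OF equiv_word_eq])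
    with u show ?thesis using class_carrier inv_word_words by blast
  qed
qed

section \<open>Evaluation of words and von Dyck's theorem\<close>

context group
begin

fun word_val :: "('c \<Rightarrow> 'a) \<Rightarrow> 'c word \<Rightarrow> 'a" where
  "word_val f [] = \<one>"
| "word_val f ((x, e) # w) = (if e then f x else inv (f x)) \<otimes> word_val f w"

lemma word_val_closed:
  "f ` S \<subseteq> carrier G \<Longrightarrow> w \<in> words S \<Longrightarrow> word_val f w \<in> carrier G"
  by (induction f w rule: word_val.induct) (auto simp: words_def)

lemma word_val_append:
  assumes "f ` S \<subseteq> carrier G" "u \<in> words S" "v \<in> words S"
  shows "word_val f (u @ v) = word_val f u \<otimes> word_val f v"
  using assms(2)
proof (induction u)
  case (Cons y u)
  obtain x e where y: "y = (x, e)" by fastforce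
  with Cons.prems have "x \<in> S" and u: "u \<in> words S" by (auto simp: words_def)
  then have "f x \<in> carrier G" using assms(1) by blast
  with u assms Cons.IH show ?case
    by (simp add: y m_assoc word_val_closed[of f S])
qed (use assms word_val_closed[of f S v] in simp)

lemma word_val_word_eq:
  assumes f: "f ` S \<subseteq> carrier G"
    and R: "\<And>u v. (u, v) \<in> R \<Longrightarrow> u \<in> words S \<Longrightarrow> v \<in> words S \<Longrightarrow> word_val f u = word_val f v"
    and "(u, v) \<in> word_eq S R"
  shows "word_val f u = word_val f v"
  using assms(3)
proof (induction rule: word_eq.induct)
  case (cancel x a b e)
  have "f x \<in> carrier G" using f cancel by blast
  moreover have "[(x, e), (x, \<not> e)] \<in> words S" "[(x, e), (x, \<not> e)] @ b \<in> words S"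
    using cancel by (auto simp: words_def)
  ultimately show ?case using f cancel word_val_closed[OF f]
    by (cases e) (simp_all add: word_val_append[OF f] m_assoc[symmetric])
next
  case (rel u v a b)
  then have "u @ b \<in> words S" "v @ b \<in> words S" by (auto simp: words_def)
  with rel R show ?case by (simp add: word_val_append[OF f])
qed auto

text \<open>This is von Dyck's theorem: evaluation of words is constant on the classes once it
  respects the relations.\<close>

lemma presented_group_hom:
  assumes f: "f ` S \<subseteq> carrier G"
    and R: "\<And>u v. (u, v) \<in> R \<Longrightarrow> u \<in> words S \<Longrightarrow> v \<in> words S \<Longrightarrow> word_val f u = word_val f v"
  obtains h where "group_hom (presented_group S R) G h"
    "\<And>x. x \<in> S \<Longrightarrow> h (word_eq S R `` {[(x, True)]}) = f x"
proof
  \<comment> \<open>A class is evaluated at an arbitrary representative;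
    \<open>word_val_word_eq\<close> makes the choice irrelevant.\<close>
  define h where "h A = word_val f (SOME w. w \<in> A)" for A
  have h: "h (word_eq S R `` {w}) = word_val f w" if "w \<in> words S" for w
  proof -
    have "w \<in> word_eq S R `` {w}" using that by (auto intro: word_eq.refl)
    then have "(w, SOME v. v \<in> word_eq S R `` {w}) \<in> word_eq S R"
      by (rule someI2) simp
    from word_val_word_eq[OF f R this] show ?thesis by (simp add: h_def)
  qed
  have app: "u @ v \<in> words S" if "u \<in> words S" "v \<in> words S" for u v
    using that by (auto simp: words_def)
  have "h \<in> hom (presented_group S R) G"
    using word_val_closed[OF f]
    by (intro homI) (auto elim!: class_cases simp: h class_mult app word_val_append[OF f])
  then show "group_hom (presented_group S R) G h"
    by (intro group_hom.intro group_presented_group group_hom_axioms.intro is_group)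
  show "h (word_eq S R `` {[(x, True)]}) = f x" if "x \<in> S" for x
    using that f by (subst h) (auto simp: words_def)
qed

end

section \<open>The braid group action\<close>

lemma sigma_in_rooted_forests:
  assumes F: "F \<in> rooted_forests n" and i: "i \<in> {1..<n}"
  shows "sigma n i F \<in> rooted_forests n"
proof -
  obtain p d where "parent_function n p d" and F: "F = forest_of_parents n p"
    using F by (rule rooted_forest_obtain_parents)
  then interpret parent_function n p d by simp
  obtain d' where "parent_function n (twist i (i + 1) p) d'"
    using parent_function_twist[of i "i + 1"] i by auto
  then interpret q: parent_function n "twist i (i + 1) p" d' .
  show ?thesis using q.in_rooted_forests sigma_eq_twist i F by simp
qed

text \<open>The depth changes with every move, so only its existence is carried along.\<close>

lemma sigma_funpow:
  assumes "parent_function n p d" and i: "i \<in> {1..<n}"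
  shows "(sigma n i ^^ k) (forest_of_parents n p) = forest_of_parents n ((twist i (i + 1) ^^ k) p) \<and>
    (\<exists>d. parent_function n ((twist i (i + 1) ^^ k) p) d)"
proof (induction k)
  case 0
  then show ?case using assms by auto
next
  case (Suc k)
  then obtain d' where "parent_function n ((twist i (i + 1) ^^ k) p) d'" by blast
  then interpret q: parent_function n "(twist i (i + 1) ^^ k) p" d' .
  show ?case using Suc q.sigma_eq_twist[OF i] q.parent_function_twist[of i "i + 1"] i by simp
qed

lemma sigma_sixth:
  assumes F: "F \<in> rooted_forests n" and i: "i \<in> {1..<n}"
  shows "(sigma n i ^^ 6) F = F"
proof -
  obtain p d where p: "parent_function n p d" and F: "F = forest_of_parents n p"
    using F by (rule rooted_forest_obtain_parents)
  then interpret parent_function n p d by simp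
  have "(twist i (i + 1) ^^ 6) p = p"
    using i by (intro twist_sixth p_neq no_2_cycle) auto
  then show ?thesis unfolding F sigma_funpow[OF p i, THEN conjunct1] by simp
qed

text \<open>Since the sixth power is the identity, the fifth power is a two-sided inverse.\<close>

lemma bij_betw_sigma:
  assumes i: "i \<in> {1..<n}"
  shows "bij_betw (sigma n i) (rooted_forests n) (rooted_forests n)"
proof -
  have pow: "(sigma n i ^^ k) F \<in> rooted_forests n" if "F \<in> rooted_forests n" for k F
    using that i by (induction k) (auto intro: sigma_in_rooted_forests)
  have six: "(sigma n i ^^ 6) F = sigma n i ((sigma n i ^^ 5) F)"
    "(sigma n i ^^ 6) F = (sigma n i ^^ 5) (sigma n i F)" for F
    by (simp_all add: numeral_eq_Suc)
  show ?thesis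
    using sigma_sixth[OF _ i] pow sigma_in_rooted_forests[OF _ i] six
    by (intro bij_betw_byWitness[where f' = "sigma n i ^^ 5"]) (auto simp del: funpow.simps)
qed

lemma sigma_commute:
  assumes F: "F \<in> rooted_forests n" and i: "i \<in> {1..<n}" "j \<in> {1..<n}"
    and ij: "\<bar>int i - int j\<bar> \<ge> 2"
  shows "sigma n i (sigma n j F) = sigma n j (sigma n i F)"
proof -
  obtain p d where "parent_function n p d" and F: "F = forest_of_parents n p"
    using F by (rule rooted_forest_obtain_parents)
  then interpret parent_function n p d by simp
  obtain d' where "parent_function n (twist i (i + 1) p) d'"
    using parent_function_twist[of i "i + 1"] i by auto
  then interpret q: parent_function n "twist i (i + 1) p" d' .
  obtain d'' where "parent_function n (twist j (j + 1) p) d''"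
    using parent_function_twist[of j "j + 1"] i by auto
  then interpret r: parent_function n "twist j (j + 1) p" d'' .
  have "twist i (i + 1) (twist j (j + 1) p) = twist j (j + 1) (twist i (i + 1) p)"
    using i ij by (intro twist_commute ballI p_neq no_2_cycle) auto
  then show ?thesis
    using i by (simp only: F sigma_eq_twist q.sigma_eq_twist r.sigma_eq_twist)
qed

lemma sigma_braid:
  assumes F: "F \<in> rooted_forests n" and i: "i \<in> {1..<n}" "i + 1 \<in> {1..<n}"
  shows "sigma n i (sigma n (i + 1) (sigma n i F)) = sigma n (i + 1) (sigma n i (sigma n (i + 1) F))"
proof -
  \<comment> \<open>Stated with an existential depth, the rule applies again to its own result;
    \<open>Suc j\<close> is the simplifier's form of \<open>j + 1\<close>.\<close>
  have step: "sigma n j (forest_of_parents n q) = forest_of_parents n (twist j (Suc j) q) \<and>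
      (\<exists>d. parent_function n (twist j (Suc j) q) d)"
    if "\<exists>d. parent_function n q d" "j \<in> {i, i + 1}" for j q
    using that i sigma_funpow[of n q _ j 1] by auto
  obtain p d where p: "parent_function n p d" and F: "F = forest_of_parents n p"
    using F by (rule rooted_forest_obtain_parents)
  then interpret parent_function n p d by simp
  have "twist i (i + 1) (twist (i + 1) (i + 2) (twist i (i + 1) p)) =
      twist (i + 1) (i + 2) (twist i (i + 1) (twist (i + 1) (i + 2) p))"
    \<comment> \<open>The two instances exclude both orientations of a 3-cycle.\<close>
    using i no_3_cycle[of i "i + 1" "i + 2"] no_3_cycle[of "i + 2" "i + 1" i]
    by (intro twist_braid p_neq no_2_cycle) auto
  moreover have "\<exists>d. parent_function n p d" using p by blast
  ultimately show ?thesis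
    by (simp add: F step)
qed

theorem corollary2p2:
  fixes n :: nat
  shows "(\<forall>i \<in> {1..<n}. \<forall>F \<in> rooted_forests n. sigma n i F \<in> rooted_forests n) \<and>
    (\<forall>i \<in> {1..<n}. \<forall>j \<in> {1..<n}. \<bar>int i - int j\<bar> \<ge> 2 \<longrightarrow>
       (\<forall>F \<in> rooted_forests n. sigma n i (sigma n j F) = sigma n j (sigma n i F))) \<and>
    (\<forall>i \<in> {1..<n}. i + 1 \<in> {1..<n} \<longrightarrow>
       (\<forall>F \<in> rooted_forests n.
          sigma n i (sigma n (i+1) (sigma n i F)) =
          sigma n (i+1) (sigma n i (sigma n (i+1) F)))) \<and>
    (\<exists>\<phi>. group_action (braid_group n) (rooted_forests n) \<phi> \<and>
       (\<forall>i \<in> {1..<n}. \<forall>F \<in> rooted_forests n. \<phi> (braid_gen n i) F = sigma n i F))"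
proof (intro conjI ballI impI)
  let ?X = "rooted_forests n"
  \<comment> \<open>Elements of \<open>Bij\<close> are extensional, so the operators are restricted
    to the forests.\<close>
  let ?s = "\<lambda>i. restrict (sigma n i) ?X"
  interpret B: group "BijGroup ?X" by (rule group_BijGroup)
  have bij: "?s i \<in> Bij ?X" "?s i \<in> carrier (BijGroup ?X)" if "i \<in> {1..<n}" for i
    using bij_betw_sigma[OF that] by (simp_all add: Bij_def BijGroup_def)
  then have carrier: "?s ` {1..<n} \<subseteq> carrier (BijGroup ?X)" by blast
  have mult: "f \<otimes>\<^bsub>BijGroup ?X\<^esub> g = compose ?X f g" if "f \<in> Bij ?X" "g \<in> Bij ?X" for f g
    using that by (simp add: BijGroup_def)
  have comp: "compose ?X f g \<in> Bij ?X" if "f \<in> Bij ?X" "g \<in> Bij ?X" for f g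
    using that by (rule compose_Bij)
  \<comment> \<open>Each braid relation becomes an equation between composites of the restricted
    operators, to be checked on forests.\<close>
  have "B.word_val ?s u = B.word_val ?s v" if "(u, v) \<in> braid_relations n" for u v
    using that unfolding braid_relations_def
  proof (elim UnE CollectE exE conjE)
    fix i j
    assume "(u, v) = ([(i, True), (j, True)], [(j, True), (i, True)])"
      and ij: "i \<in> {1..<n}" "j \<in> {1..<n}" "\<bar>int i - int j\<bar> \<ge> 2"
    moreover have "compose ?X (?s i) (?s j) = compose ?X (?s j) (?s i)"
      using ij by (auto simp: compose_def fun_eq_iff sigma_in_rooted_forests sigma_commute)
    ultimately show ?thesis using bij by (simp add: mult)
  next
    fix i
    assume "(u, v) = ([(i, True), (i+1, True), (i, True)], [(i+1, True), (i, True), (i+1, True)])"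
      and i: "i \<in> {1..<n}" "i + 1 \<in> {1..<n}"
    moreover have "compose ?X (?s i) (compose ?X (?s (i+1)) (?s i)) =
        compose ?X (?s (i+1)) (compose ?X (?s i) (?s (i+1)))"
      using i sigma_braid[OF _ i] by (auto simp: compose_def fun_eq_iff sigma_in_rooted_forests)
    ultimately show ?thesis using bij by (simp add: mult comp)
  qed
  then obtain \<phi> where "group_hom (braid_group n) (BijGroup ?X) \<phi>"
    and gen: "\<And>i. i \<in> {1..<n} \<Longrightarrow> \<phi> (braid_gen n i) = ?s i"
    using B.presented_group_hom[OF carrier, of "braid_relations n"]
    unfolding braid_group_def braid_gen_def by blast
  then show "\<exists>\<phi>. group_action (braid_group n) ?X \<phi> \<and>
      (\<forall>i \<in> {1..<n}. \<forall>F \<in> ?X. \<phi> (braid_gen n i) F = sigma n i F)"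
    by (intro exI[of _ \<phi>]) (auto simp: group_action_def)
qed (use sigma_in_rooted_forests sigma_commute sigma_braid in auto)

end
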